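(* Let $(U,g)$ be the Reissner-Nordström-de Sitter spacetime with parameters $M,e,\Lambda$ (metric and conventions as in the context), and let $\xi$ be either of the vector fields $\frac{\partial}{\partial r}$, $\frac{\partial}{\partial\theta}$. Then with respect to $\xi$: (i) the spacetime admits neither Ricci collineation nor Ricci inheritance; (ii) the spacetime does not admit curvature collineation, neither for the curvature tensor $\widetilde R$ of type $(1,3)$ nor for the curvature tensor $R$ of type $(0,4)$; (iii) the spacetime does not admit curvature inheritance, neither for the curvature tensor $\widetilde R$ of type $(1,3)$ nor for the curvature tensor $R$ of type $(0,4)$.
   Context: Metric: $M>0$ (mass), $e\neq 0$ (electric charge), $\Lambda>0$ (cosmological constant) are real constants, $f(r)=1-\frac{2M}{r}+\frac{e^2}{r^2}-\Lambda r^2$, and on the coordinate domain $U=\{(t,r,\theta,\phi): r>0,\ f(r)\ne 0,\ 0<\theta<\pi\}$ with coordinates $(t,r,\theta,\phi)$ the Reissner-Nordström-de Sitter (RNdS) metric is $g=-f\,dt^2+f^{-1}dr^2+r^2(d\theta^2+\sin^2\theta\,d\phi^2)$. $\widetilde R$ is the $(1,3)$ Riemann curvature tensor, $R(X_1,X_2,X_3,X_4)=g(\widetilde R(X_1,X_2)X_3,X_4)$, and $Ric$ is the Ricci tensor (overall sign conventions are irrelevant here). $\pounds_\xi$ is the Lie derivative. For a tensor $S\in\{\widetilde R,R,Ric\}$, the spacetime admits curvature inheritance (for $S=\widetilde R$ or $R$), respectively Ricci inheritance (for $S=Ric$), with respect to $\xi$ if there is a scalar function $\mathcal G$ on the spacetime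 with $\pounds_\xi S=\mathcal G\,S$; if this holds with $\mathcal G=0$, i.e. $\pounds_\xi S=0$, one speaks of curvature collineation, respectively Ricci collineation. *)

theory Defs
  imports "HOL-Analysis.Analysis"
begin

text \<open>
  Tensor calculus in a single coordinate chart: points and tangent vectors are elements of
  \<open>real ^ 'n\<close>, vector fields are functions on points, and tensor fields are given by their
  components with respect to the coordinate frame, the point being the last argument.
\<close>

definition partial_deriv :: "'n \<Rightarrow> (real ^ 'n \<Rightarrow> real) \<Rightarrow> real ^ 'n \<Rightarrow> real" where
  "partial_deriv i F p = deriv (\<lambda>s. F (p + s *\<^sub>R axis i 1)) 0"

definition coord_field :: "'n \<Rightarrow> real ^ 'n \<Rightarrow> real ^ 'n" where
  "coord_field i p = axis i 1"

definition dir_deriv ::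
  "(real ^ 'n::finite \<Rightarrow> real ^ 'n) \<Rightarrow> (real ^ 'n \<Rightarrow> real) \<Rightarrow> real ^ 'n \<Rightarrow> real" where
  "dir_deriv X F p = (\<Sum>a\<in>UNIV. X p $ a * partial_deriv a F p)"

definition lie_bracket ::
  "(real ^ 'n::finite \<Rightarrow> real ^ 'n) \<Rightarrow> (real ^ 'n \<Rightarrow> real ^ 'n) \<Rightarrow> real ^ 'n \<Rightarrow> real ^ 'n" where
  "lie_bracket X Y p =
     (\<chi> k. dir_deriv X (\<lambda>q. Y q $ k) p - dir_deriv Y (\<lambda>q. X q $ k) p)"

definition christoffel ::
  "(real ^ 'n::finite \<Rightarrow> real ^ 'n ^ 'n) \<Rightarrow> 'n \<Rightarrow> 'n \<Rightarrow> 'n \<Rightarrow> real ^ 'n \<Rightarrow> real" where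
  "christoffel g k i j p =
     (\<Sum>l\<in>UNIV. matrix_inv (g p) $ k $ l *
        (partial_deriv i (\<lambda>q. g q $ j $ l) p + partial_deriv j (\<lambda>q. g q $ i $ l) p
         - partial_deriv l (\<lambda>q. g q $ i $ j) p)) / 2"

text \<open>The Levi-Civita connection of \<open>g\<close>.\<close>

definition cov_deriv ::
  "(real ^ 'n::finite \<Rightarrow> real ^ 'n ^ 'n) \<Rightarrow> (real ^ 'n \<Rightarrow> real ^ 'n) \<Rightarrow> (real ^ 'n \<Rightarrow> real ^ 'n)
     \<Rightarrow> real ^ 'n \<Rightarrow> real ^ 'n" where
  "cov_deriv g X Y p =
     (\<chi> k. dir_deriv X (\<lambda>q. Y q $ k) p
        + (\<Sum>i\<in>UNIV. \<Sum>j\<in>UNIV. christoffel g k i j p * X p $ i * Y p $ j))"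

definition curvature_operator ::
  "(real ^ 'n::finite \<Rightarrow> real ^ 'n ^ 'n) \<Rightarrow> (real ^ 'n \<Rightarrow> real ^ 'n) \<Rightarrow> (real ^ 'n \<Rightarrow> real ^ 'n)
     \<Rightarrow> (real ^ 'n \<Rightarrow> real ^ 'n) \<Rightarrow> real ^ 'n \<Rightarrow> real ^ 'n" where
  "curvature_operator g X Y Z p =
     cov_deriv g X (cov_deriv g Y Z) p - cov_deriv g Y (cov_deriv g X Z) p
     - cov_deriv g (lie_bracket X Y) Z p"

text \<open>
  Index conventions, with \<open>D i\<close> the \<open>i\<close>-th coordinate field: \<open>riemann13 g l i j k\<close> is the
  \<open>l\<close>-th component of \<open>R(D i, D j) D k\<close>, \<open>riemann04 g i j k l\<close> is \<open>g(R(D i, D j) D k, D l)\<close>,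
  and \<open>ricci g j k\<close> is the trace of \<open>Z \<mapsto> R(Z, D j) D k\<close>.
\<close>

definition riemann13 ::
  "(real ^ 'n::finite \<Rightarrow> real ^ 'n ^ 'n) \<Rightarrow> 'n \<Rightarrow> 'n \<Rightarrow> 'n \<Rightarrow> 'n \<Rightarrow> real ^ 'n \<Rightarrow> real" where
  "riemann13 g l i j k p =
     curvature_operator g (coord_field i) (coord_field j) (coord_field k) p $ l"

definition riemann04 ::
  "(real ^ 'n::finite \<Rightarrow> real ^ 'n ^ 'n) \<Rightarrow> 'n \<Rightarrow> 'n \<Rightarrow> 'n \<Rightarrow> 'n \<Rightarrow> real ^ 'n \<Rightarrow> real" where
  "riemann04 g i j k l p =
     curvature_operator g (coord_field i) (coord_field j) (coord_field k) p
       \<bullet> (g p *v coord_field l p)"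

definition ricci ::
  "(real ^ 'n::finite \<Rightarrow> real ^ 'n ^ 'n) \<Rightarrow> 'n \<Rightarrow> 'n \<Rightarrow> real ^ 'n \<Rightarrow> real" where
  "ricci g j k p = (\<Sum>i\<in>UNIV. riemann13 g i i j k p)"

definition lie_deriv02 ::
  "(real ^ 'n::finite \<Rightarrow> real ^ 'n) \<Rightarrow> ('n \<Rightarrow> 'n \<Rightarrow> real ^ 'n \<Rightarrow> real)
     \<Rightarrow> 'n \<Rightarrow> 'n \<Rightarrow> real ^ 'n \<Rightarrow> real" where
  "lie_deriv02 \<xi> S i j p =
     dir_deriv \<xi> (S i j) p
     + (\<Sum>a\<in>UNIV. partial_deriv i (\<lambda>q. \<xi> q $ a) p * S a j p)
     + (\<Sum>a\<in>UNIV. partial_deriv j (\<lambda>q. \<xi> q $ a) p * S i a p)"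

definition lie_deriv04 ::
  "(real ^ 'n::finite \<Rightarrow> real ^ 'n) \<Rightarrow> ('n \<Rightarrow> 'n \<Rightarrow> 'n \<Rightarrow> 'n \<Rightarrow> real ^ 'n \<Rightarrow> real)
     \<Rightarrow> 'n \<Rightarrow> 'n \<Rightarrow> 'n \<Rightarrow> 'n \<Rightarrow> real ^ 'n \<Rightarrow> real" where
  "lie_deriv04 \<xi> S i j k l p =
     dir_deriv \<xi> (S i j k l) p
     + (\<Sum>a\<in>UNIV. partial_deriv i (\<lambda>q. \<xi> q $ a) p * S a j k l p)
     + (\<Sum>a\<in>UNIV. partial_deriv j (\<lambda>q. \<xi> q $ a) p * S i a k l p)
     + (\<Sum>a\<in>UNIV. partial_deriv k (\<lambda>q. \<xi> q $ a) p * S i j a l p)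
     + (\<Sum>a\<in>UNIV. partial_deriv l (\<lambda>q. \<xi> q $ a) p * S i j k a p)"

text \<open>The first index of a tensor of type (1,3) is the contravariant one.\<close>

definition lie_deriv13 ::
  "(real ^ 'n::finite \<Rightarrow> real ^ 'n) \<Rightarrow> ('n \<Rightarrow> 'n \<Rightarrow> 'n \<Rightarrow> 'n \<Rightarrow> real ^ 'n \<Rightarrow> real)
     \<Rightarrow> 'n \<Rightarrow> 'n \<Rightarrow> 'n \<Rightarrow> 'n \<Rightarrow> real ^ 'n \<Rightarrow> real" where
  "lie_deriv13 \<xi> S l i j k p =
     dir_deriv \<xi> (S l i j k) p
     - (\<Sum>a\<in>UNIV. partial_deriv a (\<lambda>q. \<xi> q $ l) p * S a i j k p)
     + (\<Sum>a\<in>UNIV. partial_deriv i (\<lambda>q. \<xi> q $ a) p * S l a j k p)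
     + (\<Sum>a\<in>UNIV. partial_deriv j (\<lambda>q. \<xi> q $ a) p * S l i a k p)
     + (\<Sum>a\<in>UNIV. partial_deriv k (\<lambda>q. \<xi> q $ a) p * S l i j a p)"

definition ricci_collineation ::
  "(real ^ 'n::finite) set \<Rightarrow> (real ^ 'n \<Rightarrow> real ^ 'n ^ 'n) \<Rightarrow> (real ^ 'n \<Rightarrow> real ^ 'n) \<Rightarrow> bool" where
  "ricci_collineation U g \<xi> \<longleftrightarrow>
     (\<forall>p\<in>U. \<forall>i j. lie_deriv02 \<xi> (ricci g) i j p = 0)"

definition ricci_inheritance ::
  "(real ^ 'n::finite) set \<Rightarrow> (real ^ 'n \<Rightarrow> real ^ 'n ^ 'n) \<Rightarrow> (real ^ 'n \<Rightarrow> real ^ 'n) \<Rightarrow> bool" where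
  "ricci_inheritance U g \<xi> \<longleftrightarrow>
     (\<exists>G :: real ^ 'n \<Rightarrow> real. \<forall>p\<in>U. \<forall>i j.
        lie_deriv02 \<xi> (ricci g) i j p = G p * ricci g i j p)"

definition curvature_collineation13 ::
  "(real ^ 'n::finite) set \<Rightarrow> (real ^ 'n \<Rightarrow> real ^ 'n ^ 'n) \<Rightarrow> (real ^ 'n \<Rightarrow> real ^ 'n) \<Rightarrow> bool" where
  "curvature_collineation13 U g \<xi> \<longleftrightarrow>
     (\<forall>p\<in>U. \<forall>l i j k. lie_deriv13 \<xi> (riemann13 g) l i j k p = 0)"

definition curvature_inheritance13 ::
  "(real ^ 'n::finite) set \<Rightarrow> (real ^ 'n \<Rightarrow> real ^ 'n ^ 'n) \<Rightarrow> (real ^ 'n \<Rightarrow> real ^ 'n) \<Rightarrow> bool" where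
  "curvature_inheritance13 U g \<xi> \<longleftrightarrow>
     (\<exists>G :: real ^ 'n \<Rightarrow> real. \<forall>p\<in>U. \<forall>l i j k.
        lie_deriv13 \<xi> (riemann13 g) l i j k p = G p * riemann13 g l i j k p)"

definition curvature_collineation04 ::
  "(real ^ 'n::finite) set \<Rightarrow> (real ^ 'n \<Rightarrow> real ^ 'n ^ 'n) \<Rightarrow> (real ^ 'n \<Rightarrow> real ^ 'n) \<Rightarrow> bool" where
  "curvature_collineation04 U g \<xi> \<longleftrightarrow>
     (\<forall>p\<in>U. \<forall>i j k l. lie_deriv04 \<xi> (riemann04 g) i j k l p = 0)"

definition curvature_inheritance04 ::
  "(real ^ 'n::finite) set \<Rightarrow> (real ^ 'n \<Rightarrow> real ^ 'n ^ 'n) \<Rightarrow> (real ^ 'n \<Rightarrow> real ^ 'n) \<Rightarrow> bool" where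
  "curvature_inheritance04 U g \<xi> \<longleftrightarrow>
     (\<exists>G :: real ^ 'n \<Rightarrow> real. \<forall>p\<in>U. \<forall>i j k l.
        lie_deriv04 \<xi> (riemann04 g) i j k l p = G p * riemann04 g i j k l p)"

text \<open>
  The coordinates of \<open>p :: real ^ 4\<close> are \<open>(t, r, \<theta>, \<phi>) = (p $ 1, p $ 2, p $ 3, p $ 4)\<close>;
  in the index type \<open>4\<close> the numeral \<open>4\<close> equals \<open>0\<close>, so the four indices are distinct.
\<close>

definition rnds_f :: "real \<Rightarrow> real \<Rightarrow> real \<Rightarrow> real \<Rightarrow> real" where
  "rnds_f M e \<Lambda> r = 1 - 2 * M / r + e\<^sup>2 / r\<^sup>2 - \<Lambda> * r\<^sup>2"

definition rnds_domain :: "real \<Rightarrow> real \<Rightarrow> real \<Rightarrow> (real ^ 4) set" where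
  "rnds_domain M e \<Lambda> =
     {p. p $ 2 > 0 \<and> rnds_f M e \<Lambda> (p $ 2) \<noteq> 0 \<and> 0 < p $ 3 \<and> p $ 3 < pi}"

definition rnds_metric :: "real \<Rightarrow> real \<Rightarrow> real \<Rightarrow> real ^ 4 \<Rightarrow> real ^ 4 ^ 4" where
  "rnds_metric M e \<Lambda> p =
     (\<chi> i j. if i \<noteq> j then 0
        else if i = 1 then - rnds_f M e \<Lambda> (p $ 2)
        else if i = 2 then 1 / rnds_f M e \<Lambda> (p $ 2)
        else if i = 3 then (p $ 2)\<^sup>2
        else (p $ 2)\<^sup>2 * (sin (p $ 3))\<^sup>2)"

end

theory Submission
  imports Defs
begin

text \<open>
  Both coordinate fields have constant components, so the Lie derivative along either of them is
  the partial derivative of the components. A collineation is an inheritance with factor \<open>0\<close>, so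
  only inheritance has to be refuted, and this is done at one point of the domain by comparing
  two tensor components that differ only in a factor \<open>g $ j $ j\<close>.

  The metric is diagonal and static, and its curvature is computed for an arbitrary radial profile \<open>f\<close>.
  The curvature components with pairwise repeated indices are then \<open>sectional i j * g $ j $ j\<close>,
  where the sectional curvature of the \<open>(i, j)\<close> coordinate plane is a function of \<open>r\<close> alone
  (\<open>riemann13_sectional\<close>). Each of the three tensors therefore contains pairs of components with
  a common radial coefficient \<open>c(r)\<close>, of the following two kinds.

  \<^item> The components \<open>- c f\<close> and \<open>c / f\<close>, from \<open>g $ 1 $ 1\<close> and \<open>g $ 2 $ 2\<close>. If the
    \<open>r\<close>-derivative multiplies both by the same factor, the logarithmic derivatives of \<open>c f\<close> and
    \<open>c / f\<close> agree, which forces \<open>c f' = 0\<close> (\<open>no_common_factor_r\<close>).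
  \<^item> The components \<open>c r\<^sup>2\<close> and \<open>c r\<^sup>2 sin\<^sup>2 \<theta>\<close>, from \<open>g $ 3 $ 3\<close> and \<open>g $ 4 $ 4\<close>. The first
    does not depend on \<open>\<theta>\<close>, so a common factor for the \<open>\<theta>\<close>-derivative is \<open>0\<close> where \<open>c\<close> does not
    vanish, and the second then forces \<open>cos \<theta> = 0\<close> (\<open>no_common_factor_theta\<close>).

  For the two curvature tensors the coefficient is, up to nonvanishing factors, the
  sectional curvature \<open>- f' / (2 r)\<close> of a plane spanned by one of the first two and one of the last
  two coordinate directions; for the Ricci tensor it is the Ricci eigenvalue
  \<open>3 \<Lambda> - e\<^sup>2 / r\<^sup>4\<close> in the first case and \<open>3 \<Lambda> + e\<^sup>2 / r\<^sup>4\<close> in the second. As \<open>e \<noteq> 0\<close>, the terms in \<open>e\<^sup>2\<close> dominate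
  near \<open>r = 0\<close>, so that \<open>f\<close>, \<open>f'\<close> and these eigenvalues are nonzero for some small \<open>r\<close>.
\<close>

section \<open>Tensor calculus with coordinate fields\<close>

lemma partial_deriv_const [simp]: "partial_deriv i (\<lambda>q. c) p = 0"
  by (simp add: partial_deriv_def)

text \<open>
  A partial derivative sees only the values of \<open>F\<close> near \<open>p\<close> on the coordinate line, so a formula
  for \<open>F\<close> that is valid on an open domain suffices to compute it.
\<close>

lemma partial_deriv_eqI:
  fixes p :: "real ^ 'n"
  assumes "open U" "p \<in> U"
    and F: "\<And>s. p + s *\<^sub>R axis i 1 \<in> U \<Longrightarrow> F (p + s *\<^sub>R axis i 1) = h (p $ i + s)"
    and h: "(h has_real_derivative D) (at (p $ i))"
  shows "partial_deriv i F p = D"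
proof -
  have "((\<lambda>s. p + s *\<^sub>R axis i 1) \<longlongrightarrow> p + 0 *\<^sub>R axis i 1) (nhds (0::real))"
    by (intro tendsto_intros filterlim_ident)
  then have "\<forall>\<^sub>F s in nhds 0. p + s *\<^sub>R axis i 1 \<in> U"
    using assms(1,2) by (simp add: topological_tendstoD)
  then have "\<forall>\<^sub>F s in nhds 0. F (p + s *\<^sub>R axis i 1) = h (p $ i + s)"
    by (rule eventually_mono) (rule F)
  moreover have "((\<lambda>s. h (p $ i + s)) has_real_derivative D) (at 0)"
    using h DERIV_shift[of h D 0 "p $ i"] by (simp add: add.commute)
  ultimately have "((\<lambda>s. F (p + s *\<^sub>R axis i 1)) has_real_derivative D) (at 0)"
    by (subst DERIV_cong_ev[OF refl _ refl])
  then show ?thesis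
    unfolding partial_deriv_def by (rule DERIV_imp_deriv)
qed

lemma dir_deriv_coord: "dir_deriv (coord_field i) F p = partial_deriv i F p"
  unfolding dir_deriv_def coord_field_def axis_def
  by (simp add: if_distrib if_distribR cong: if_cong)

lemma partial_deriv_coord_field [simp]: "partial_deriv i (\<lambda>q. coord_field j q $ k) p = 0"
  by (simp add: coord_field_def)

lemma cov_deriv_coord:
  "cov_deriv g (coord_field i) Y p $ l =
     partial_deriv i (\<lambda>q. Y q $ l) p + (\<Sum>m\<in>UNIV. christoffel g l i m p * Y p $ m)"
proof -
  have "(\<Sum>a\<in>UNIV. \<Sum>j\<in>UNIV. christoffel g l a j p * coord_field i p $ a * Y p $ j) =
        (\<Sum>j\<in>UNIV. \<Sum>a\<in>UNIV. christoffel g l a j p * coord_field i p $ a * Y p $ j)"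
    by (rule sum.swap)
  also have "\<dots> = (\<Sum>j\<in>UNIV. christoffel g l i j p * Y p $ j)"
    by (simp add: coord_field_def axis_def if_distrib if_distribR cong: if_cong)
  finally show ?thesis
    by (simp add: cov_deriv_def dir_deriv_coord)
qed

lemma cov_deriv_coord_coord:
  "cov_deriv g (coord_field j) (coord_field k) p $ l = christoffel g l j k p"
  unfolding cov_deriv_coord
  by (simp add: coord_field_def axis_def if_distrib cong: if_cong)

text \<open>
  The coordinate expression of the curvature: the bracket of two coordinate fields vanishes, and the
  components of \<open>cov_deriv g (coord_field j) (coord_field k)\<close> are Christoffel symbols.
\<close>

lemma riemann13_christoffel:
  "riemann13 g l i j k p =
     partial_deriv i (christoffel g l j k) p - partial_deriv j (christoffel g l i k) p
     + (\<Sum>m\<in>UNIV. christoffel g l i m p * christoffel g m j k p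
                   - christoffel g l j m p * christoffel g m i k p)"
proof -
  have "lie_bracket (coord_field i) (coord_field j) = (\<lambda>_. 0)"
    by (simp add: lie_bracket_def fun_eq_iff vec_eq_iff dir_deriv_def)
  then have "cov_deriv g (lie_bracket (coord_field i) (coord_field j)) (coord_field k) p = 0"
    by (simp add: cov_deriv_def vec_eq_iff dir_deriv_def)
  then show ?thesis
    by (simp add: riemann13_def curvature_operator_def cov_deriv_coord[where Y = "cov_deriv _ _ _"]
        cov_deriv_coord_coord sum_subtractf)
qed

text \<open>
  All correction terms of the Lie derivative contain partial derivatives of the
  components of the field, and these are constant.
\<close>

lemma lie_deriv_coord:
  "lie_deriv02 (coord_field a) S2 i j p = partial_deriv a (S2 i j) p"
  "lie_deriv04 (coord_field a) S4 i j k l p = partial_deriv a (S4 i j k l) p"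
  "lie_deriv13 (coord_field a) S4 i j k l p = partial_deriv a (S4 i j k l) p"
  by (simp_all add: lie_deriv02_def lie_deriv04_def lie_deriv13_def dir_deriv_coord)

section \<open>Diagonal metrics\<close>

lemma matrix_inv_eqI:
  fixes A B :: "real ^ 'n ^ 'n"
  assumes "A ** B = mat 1" "B ** A = mat 1"
  shows "matrix_inv A = B"
proof -
  have inv: "A ** matrix_inv A = mat 1 \<and> matrix_inv A ** A = mat 1"
    unfolding matrix_inv_def by (rule someI[of _ B]) (simp add: assms)
  have "matrix_inv A = matrix_inv A ** (A ** B)"
    by (simp add: assms)
  also have "\<dots> = B"
    by (simp add: matrix_mul_assoc inv)
  finally show ?thesis .
qed

lemma diagonal_matrix_mult:
  fixes a b :: "'n::finite \<Rightarrow> real"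
  shows "(\<chi> i j. if i = j then a i else 0) ** (\<chi> i j. if i = j then b i else 0) =
    (\<chi> i j. if i = j then a i * b i else 0)"
proof -
  have "(\<Sum>k\<in>UNIV. (if i = k then a i else 0) * (if k = j then b k else 0)) =
      (\<Sum>k\<in>UNIV. if i = k then a i * (if i = j then b i else 0) else 0)" for i j :: 'n
    by (rule sum.cong) auto
  then show ?thesis
    by (simp add: matrix_matrix_mult_def vec_eq_iff)
qed

lemma christoffel_diagonal:
  fixes g :: "real ^ 'n \<Rightarrow> real ^ 'n ^ 'n"
  assumes g: "\<And>i j. i \<noteq> j \<Longrightarrow> g p $ i $ j = 0" and nz: "\<And>i. g p $ i $ i \<noteq> 0"
  shows "christoffel g k i j p =
    (partial_deriv i (\<lambda>q. g q $ j $ k) p + partial_deriv j (\<lambda>q. g q $ i $ k) p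
      - partial_deriv k (\<lambda>q. g q $ i $ j) p) / (2 * g p $ k $ k)"
proof -
  define d where "d i = g p $ i $ i" for i
  define B :: "real ^ 'n ^ 'n" where "B = (\<chi> i j. if i = j then 1 / d i else 0)"
  have "g p = (\<chi> i j. if i = j then d i else 0)"
    using g by (auto simp: d_def vec_eq_iff)
  moreover have "d i \<noteq> 0" for i
    using nz by (simp add: d_def)
  ultimately have "g p ** B = mat 1" "B ** g p = mat 1"
    by (simp_all only: B_def diagonal_matrix_mult) (simp_all add: mat_def cong: if_cong)
  then have "matrix_inv (g p) = B"
    by (rule matrix_inv_eqI)
  moreover have "(\<Sum>l\<in>UNIV. B $ k $ l * c l) = (\<Sum>l\<in>UNIV. if k = l then c l / d k else 0)" for c
    by (rule sum.cong) (auto simp: B_def)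
  ultimately show ?thesis
    unfolding christoffel_def by (simp add: d_def)
qed

lemma riemann04_diagonal:
  fixes g :: "real ^ 'n \<Rightarrow> real ^ 'n ^ 'n"
  assumes g: "\<And>i j. i \<noteq> j \<Longrightarrow> g p $ i $ j = 0"
  shows "riemann04 g i j k l p = riemann13 g l i j k p * g p $ l $ l"
proof -
  have "(g p *v coord_field l p) $ m = g p $ m $ l" for m
    by (simp add: matrix_vector_mult_def coord_field_def axis_def if_distrib cong: if_cong)
  also have "g p $ m $ l = (if m = l then g p $ l $ l else 0)" for m
    using g by simp
  finally have lower: "(g p *v coord_field l p) $ m = (if m = l then g p $ l $ l else 0)" for m .
  show ?thesis
    unfolding riemann04_def riemann13_def inner_vec_def lower
    by (simp add: if_distrib cong: if_cong)
qed

section \<open>Static metrics with a general radial profile\<close>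

definition static_domain :: "(real \<Rightarrow> real) \<Rightarrow> (real ^ 4) set" where
  "static_domain f = {p. p $ 2 > 0 \<and> f (p $ 2) \<noteq> 0 \<and> 0 < p $ 3 \<and> p $ 3 < pi}"

definition static_metric :: "(real \<Rightarrow> real) \<Rightarrow> real ^ 4 \<Rightarrow> real ^ 4 ^ 4" where
  "static_metric f p =
     (\<chi> i j. if i \<noteq> j then 0
        else if i = 1 then - f (p $ 2)
        else if i = 2 then 1 / f (p $ 2)
        else if i = 3 then (p $ 2)\<^sup>2
        else (p $ 2)\<^sup>2 * (sin (p $ 3))\<^sup>2)"

text \<open>
  Lie derivatives of the Ricci components, which contain \<open>f''\<close>, call for one more
  differentiability assumption.
\<close>

locale static_profile =
  fixes f f' f'' :: "real \<Rightarrow> real"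
  assumes deriv_f: "r > 0 \<Longrightarrow> (f has_real_derivative f' r) (at r)"
    and deriv_f': "r > 0 \<Longrightarrow> (f' has_real_derivative f'' r) (at r)"
    and differentiable_f'': "r > 0 \<Longrightarrow> f'' field_differentiable at r"
begin

abbreviation "U \<equiv> static_domain f"
abbreviation "g \<equiv> static_metric f"

lemma open_domain: "open U"
proof -
  have "continuous_on {0<..} f"
    by (rule DERIV_continuous_on[where D = f']) (simp add: deriv_f has_field_derivative_at_within)
  then have "open ({0<..} \<inter> f -` (- {0}))"
    by (rule continuous_open_preimage) auto
  then have "open ((\<lambda>p::real ^ 4. p $ 2) -` ({0<..} \<inter> f -` (- {0})))"
    by (rule open_vimage) (rule continuous_on_component[OF continuous_on_id])
  moreover have "open ((\<lambda>p::real ^ 4. p $ 3) -` {0<..<pi})"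
    by (rule open_vimage[OF open_greaterThanLessThan]) (rule continuous_on_component[OF continuous_on_id])
  ultimately have "open ((\<lambda>p::real ^ 4. p $ 2) -` ({0<..} \<inter> f -` (- {0})) \<inter> (\<lambda>p. p $ 3) -` {0<..<pi})"
    by (rule open_Int)
  also have "\<dots> = U"
    by (auto simp: static_domain_def)
  finally show ?thesis .
qed

text \<open>
  The metric and everything derived from it depends on \<open>r\<close> and \<open>\<theta>\<close> only, so its partial
  derivatives reduce to ordinary derivatives of functions of these two variables.
\<close>

lemma partial_deriv_static:
  assumes "p \<in> U" and F: "\<And>q. q \<in> U \<Longrightarrow> F q = H (q $ 2) (q $ 3)"
  shows "partial_deriv 1 F p = 0"
    and "((\<lambda>r. H r (p $ 3)) has_real_derivative D) (at (p $ 2)) \<Longrightarrow> partial_deriv 2 F p = D"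
    and "((\<lambda>\<theta>. H (p $ 2) \<theta>) has_real_derivative D) (at (p $ 3)) \<Longrightarrow> partial_deriv 3 F p = D"
    and "partial_deriv 4 F p = 0"
proof -
  show "partial_deriv 1 F p = 0"
    by (rule partial_deriv_eqI[OF open_domain assms(1), where h = "\<lambda>_. H (p $ 2) (p $ 3)"])
       (simp_all add: F axis_def)
  show "partial_deriv 4 F p = 0"
    by (rule partial_deriv_eqI[OF open_domain assms(1), where h = "\<lambda>_. H (p $ 2) (p $ 3)"])
       (simp_all add: F axis_def)
  show "((\<lambda>r. H r (p $ 3)) has_real_derivative D) (at (p $ 2)) \<Longrightarrow> partial_deriv 2 F p = D"
    by (rule partial_deriv_eqI[OF open_domain assms(1), where h = "\<lambda>r. H r (p $ 3)"])
       (simp_all add: F axis_def)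
  show "((\<lambda>\<theta>. H (p $ 2) \<theta>) has_real_derivative D) (at (p $ 3)) \<Longrightarrow> partial_deriv 3 F p = D"
    by (rule partial_deriv_eqI[OF open_domain assms(1), where h = "\<lambda>\<theta>. H (p $ 2) \<theta>"])
       (simp_all add: F axis_def)
qed

lemma domainD:
  assumes "p \<in> U"
  shows "p $ 2 > 0" "p $ 2 \<noteq> 0" "f (p $ 2) \<noteq> 0" "sin (p $ 3) \<noteq> 0"
  using assms sin_gt_zero[of "p $ 3"] by (auto simp: static_domain_def)

lemma metric_nth:
  "g p $ i $ j = (if i \<noteq> j then 0 else if i = 1 then - f (p $ 2) else if i = 2 then 1 / f (p $ 2)
     else if i = 3 then (p $ 2)\<^sup>2 else (p $ 2)\<^sup>2 * (sin (p $ 3))\<^sup>2)"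
  by (simp add: static_metric_def)

lemma metric_diagonal: "i \<noteq> j \<Longrightarrow> g p $ i $ j = 0"
  by (simp add: metric_nth)

lemma metric_diag_nonzero: "p \<in> U \<Longrightarrow> g p $ i $ i \<noteq> 0"
  using domainD[of p] by (simp add: metric_nth)

lemma partial_deriv_metric:
  assumes p: "p \<in> U"
  shows "partial_deriv a (\<lambda>q. g q $ i $ j) p =
    (if i \<noteq> j then 0
     else if a = 2 then (if i = 1 then - f' (p $ 2) else if i = 2 then - f' (p $ 2) / (f (p $ 2))\<^sup>2
       else if i = 3 then 2 * p $ 2 else 2 * p $ 2 * (sin (p $ 3))\<^sup>2)
     else if a = 3 \<and> i = 4 then (p $ 2)\<^sup>2 * (2 * sin (p $ 3) * cos (p $ 3))
     else 0)"
proof -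
  note D = deriv_f[OF domainD(1)[OF p]] domainD[OF p]
  define H where "H i r \<theta> = (if i = (1::4) then - f r else if i = 2 then 1 / f r
     else if i = 3 then r\<^sup>2 else r\<^sup>2 * (sin \<theta>)\<^sup>2)" for i r \<theta>
  have H: "g q $ i $ i = H i (q $ 2) (q $ 3)" for q i
    by (simp add: metric_nth H_def)
  have 1: "((\<lambda>r. H i r (p $ 3)) has_real_derivative
      (if i = 1 then - f' (p $ 2) else if i = 2 then - f' (p $ 2) / (f (p $ 2))\<^sup>2
       else if i = 3 then 2 * p $ 2 else 2 * p $ 2 * (sin (p $ 3))\<^sup>2)) (at (p $ 2))" for i
    using exhaust_4[of i] D unfolding H_def
    by (auto intro!: derivative_eq_intros simp: power2_eq_square)
  have 2: "((\<lambda>\<theta>. H i (p $ 2) \<theta>) has_real_derivative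
      (if i = 4 then (p $ 2)\<^sup>2 * (2 * sin (p $ 3) * cos (p $ 3)) else 0)) (at (p $ 3))" for i
    using exhaust_4[of i] unfolding H_def by (auto intro!: derivative_eq_intros)
  note P = partial_deriv_static[OF p, where F = "\<lambda>q. g q $ i $ i" and H = "H i" for i, OF H]
  show ?thesis
    using exhaust_4[of a] P(1,4)[of i] P(2)[OF 1, of i] P(3)[OF 2, of i] metric_diagonal[of i j]
    by (cases "i = j") (auto simp del: metric_diagonal)
qed

definition christoffel_table :: "4 \<Rightarrow> 4 \<Rightarrow> 4 \<Rightarrow> real \<Rightarrow> real \<Rightarrow> real" where
  "christoffel_table k i j r \<theta> =
    (if k = 1 \<and> (i, j) \<in> {(1, 2), (2, 1)} then f' r / (2 * f r)
     else if k = 2 \<and> i = 1 \<and> j = 1 then f r * f' r / 2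
     else if k = 2 \<and> i = 2 \<and> j = 2 then - f' r / (2 * f r)
     else if k = 2 \<and> i = 3 \<and> j = 3 then - r * f r
     else if k = 2 \<and> i = 4 \<and> j = 4 then - r * f r * (sin \<theta>)\<^sup>2
     else if k = 3 \<and> (i, j) \<in> {(2, 3), (3, 2)} then 1 / r
     else if k = 3 \<and> i = 4 \<and> j = 4 then - sin \<theta> * cos \<theta>
     else if k = 4 \<and> (i, j) \<in> {(2, 4), (4, 2)} then 1 / r
     else if k = 4 \<and> (i, j) \<in> {(3, 4), (4, 3)} then cos \<theta> / sin \<theta>
     else 0)"

lemma christoffel_eq:
  assumes p: "p \<in> U"
  shows "christoffel g k i j p = christoffel_table k i j (p $ 2) (p $ 3)"
proof -
  have "christoffel g k i j p =
    (partial_deriv i (\<lambda>q. g q $ j $ k) p + partial_deriv j (\<lambda>q. g q $ i $ k) p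
      - partial_deriv k (\<lambda>q. g q $ i $ j) p) / (2 * g p $ k $ k)"
    by (rule christoffel_diagonal) (simp_all add: metric_diagonal metric_diag_nonzero[OF p])
  also have "\<dots> = christoffel_table k i j (p $ 2) (p $ 3)"
    using exhaust_4[of k] exhaust_4[of i] exhaust_4[of j] domainD(2-4)[OF p]
    unfolding partial_deriv_metric[OF p] unfolding metric_nth christoffel_table_def
    by (elim disjE; clarsimp simp add: power2_eq_square)
  finally show ?thesis .
qed

lemma partial_deriv_christoffel:
  assumes p: "p \<in> U"
  shows "partial_deriv 1 (christoffel g k i j) p = 0"
    and "((\<lambda>r. christoffel_table k i j r (p $ 3)) has_real_derivative D) (at (p $ 2)) \<Longrightarrow>
         partial_deriv 2 (christoffel g k i j) p = D"
    and "((\<lambda>\<theta>. christoffel_table k i j (p $ 2) \<theta>) has_real_derivative D) (at (p $ 3)) \<Longrightarrow>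
         partial_deriv 3 (christoffel g k i j) p = D"
    and "partial_deriv 4 (christoffel g k i j) p = 0"
  using partial_deriv_static[OF p, where F = "christoffel g k i j" and H = "christoffel_table k i j"] christoffel_eq
  by blast+


section \<open>Curvature of static metrics\<close>

text \<open>
  The diagonal value \<open>0\<close> lets the Ricci coefficient be written as a sum over all indices.
\<close>

definition sectional :: "4 \<Rightarrow> 4 \<Rightarrow> real \<Rightarrow> real" where
  "sectional i j r =
    (if i = j then 0
     else if (i, j) \<in> {(1, 2), (2, 1)} then - f'' r / 2
     else if (i, j) \<in> {(3, 4), (4, 3)} then (1 - f r) / r\<^sup>2
     else - f' r / (2 * r))"

lemma riemann13_sectional:
  assumes p: "p \<in> U"
  shows "riemann13 g i i j j p = sectional i j (p $ 2) * g p $ j $ j"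
proof (cases "i = j")
  case True
  then show ?thesis by (simp add: sectional_def riemann13_christoffel)
next
  case False
  note P = partial_deriv_christoffel[OF p]
  note nz = domainD[OF p]
  note D = deriv_f[OF domainD(1)[OF p]] deriv_f'[OF domainD(1)[OF p]]
  \<comment> \<open>As a conditional rewrite rule this removes every derivative that is not computed below.\<close>
  have [simp]: "partial_deriv a (christoffel g k i j) p = 0" if "\<And>r \<theta>. christoffel_table k i j r \<theta> = 0" for a k i j
    using exhaust_4[of a] P(1,4) P(2,3)[of k i j 0] that by auto
  have [simp]: "partial_deriv 2 (christoffel g 1 1 2) p
      = f'' (p $ 2) / (2 * f (p $ 2)) - (f' (p $ 2))\<^sup>2 / (2 * (f (p $ 2))\<^sup>2)"
    by (rule P(2)) (use nz in \<open>auto simp: christoffel_table_def power2_eq_square field_simps intro!: derivative_eq_intros D\<close>)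
  have [simp]: "partial_deriv 2 (christoffel g 2 1 1) p = ((f' (p $ 2))\<^sup>2 + f (p $ 2) * f'' (p $ 2)) / 2"
    by (rule P(2)) (auto simp: christoffel_table_def power2_eq_square intro!: derivative_eq_intros D)
  have [simp]: "partial_deriv 2 (christoffel g 2 3 3) p = - f (p $ 2) - p $ 2 * f' (p $ 2)"
    by (rule P(2)) (auto simp: christoffel_table_def intro!: derivative_eq_intros D)
  have [simp]: "partial_deriv 2 (christoffel g 2 4 4) p =
      (- f (p $ 2) - p $ 2 * f' (p $ 2)) * (sin (p $ 3))\<^sup>2"
    by (rule P(2)) (auto simp: christoffel_table_def algebra_simps intro!: derivative_eq_intros D)
  have [simp]: "partial_deriv 3 (christoffel g 3 4 4) p = (sin (p $ 3))\<^sup>2 - (cos (p $ 3))\<^sup>2"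
    by (rule P(3)) (auto simp: christoffel_table_def power2_eq_square intro!: derivative_eq_intros)
  have [simp]: "partial_deriv 2 (christoffel g 3 3 2) p = - 1 / (p $ 2)\<^sup>2"
    "partial_deriv 2 (christoffel g 4 4 2) p = - 1 / (p $ 2)\<^sup>2"
    by (rule P(2); use nz in \<open>auto simp: christoffel_table_def power2_eq_square intro!: derivative_eq_intros\<close>)+
  have "- (sin \<theta> * sin \<theta>) - cos \<theta> * cos \<theta> = - 1" for \<theta> :: real
    using sin_cos_squared_add[of \<theta>] by (simp add: power2_eq_square)
  then have [simp]: "partial_deriv 3 (christoffel g 4 4 3) p = - 1 / (sin (p $ 3))\<^sup>2"
    by (intro P(3)) (use nz in \<open>auto simp: christoffel_table_def power2_eq_square intro!: derivative_eq_intros\<close>)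
  show ?thesis
    using exhaust_4[of i] exhaust_4[of j] False nz
    unfolding riemann13_christoffel christoffel_eq[OF p] sum_4
    by (elim disjE; simp add: P(1,4) metric_nth sectional_def christoffel_table_def;
        simp add: field_simps power2_eq_square)
qed

definition ricci_coeff :: "4 \<Rightarrow> real \<Rightarrow> real" where
  "ricci_coeff j r = (\<Sum>i\<in>UNIV. sectional i j r)"

lemma ricci_diagonal: "p \<in> U \<Longrightarrow> ricci g j j p = ricci_coeff j (p $ 2) * g p $ j $ j"
  by (simp add: ricci_def riemann13_sectional ricci_coeff_def sum_distrib_right)

lemma riemann04_sectional:
  "p \<in> U \<Longrightarrow> riemann04 g i j j i p = sectional i j (p $ 2) * g p $ j $ j * g p $ i $ i"
  by (simp add: riemann04_diagonal metric_diagonal riemann13_sectional)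

lemma ricci_coeff_values:
  "ricci_coeff 1 r = - f'' r / 2 - f' r / r"
  "ricci_coeff 2 r = - f'' r / 2 - f' r / r"
  "ricci_coeff 3 r = (1 - f r) / r\<^sup>2 - f' r / r"
  "ricci_coeff 4 r = (1 - f r) / r\<^sup>2 - f' r / r"
  by (simp_all add: ricci_coeff_def sum_4 sectional_def)

section \<open>Components that cannot share an inheritance factor\<close>

text \<open>
  With a common factor, \<open>(c f)' / (c f) = (c / f)' / (c / f)\<close>. Cleared of denominators, the two sides
  are \<open>c' f + c f'\<close> and \<open>c' f - c f'\<close>.
\<close>

lemma no_common_factor_r:
  assumes p: "p \<in> U" and c: "c field_differentiable at (p $ 2)"
    and S1: "\<And>q. q \<in> U \<Longrightarrow> S1 q = c (q $ 2) * g q $ 1 $ 1"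
    and S2: "\<And>q. q \<in> U \<Longrightarrow> S2 q = c (q $ 2) * g q $ 2 $ 2"
    and G: "partial_deriv 2 S1 p = G * S1 p" "partial_deriv 2 S2 p = G * S2 p"
  shows "c (p $ 2) = 0 \<or> f' (p $ 2) = 0"
proof -
  obtain c' where c': "(c has_real_derivative c') (at (p $ 2))"
    using c by (auto simp: field_differentiable_def)
  note D = c' deriv_f[OF domainD(1)[OF p]]
  note nz = domainD(3)[OF p]
  have "partial_deriv 2 S1 p = - (c' * f (p $ 2) + c (p $ 2) * f' (p $ 2))"
    by (rule partial_deriv_static(2)[OF p, where H = "\<lambda>r \<theta>. - (c r * f r)"])
       (auto simp: S1 metric_nth intro!: derivative_eq_intros D)
  then have 1: "c' * f (p $ 2) + c (p $ 2) * f' (p $ 2) = G * c (p $ 2) * f (p $ 2)"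
    using G(1) S1[OF p] by (simp add: metric_nth)
  have "partial_deriv 2 S2 p = (c' * f (p $ 2) - c (p $ 2) * f' (p $ 2)) / (f (p $ 2) * f (p $ 2))"
    by (rule partial_deriv_static(2)[OF p, where H = "\<lambda>r \<theta>. c r / f r"])
       (use nz in \<open>auto simp: S2 metric_nth intro!: derivative_eq_intros D\<close>)
  then have "c' * f (p $ 2) - c (p $ 2) * f' (p $ 2) = G * c (p $ 2) * f (p $ 2)"
    using G(2) S2[OF p] nz by (simp add: metric_nth field_simps)
  with 1 have "c (p $ 2) * f' (p $ 2) = 0" by linarith
  then show ?thesis by simp
qed

text \<open>
  The component \<open>c r\<^sup>2\<close> is constant in \<open>\<theta>\<close>, which leaves \<open>0\<close> as the only possible factor, whereas
  \<open>c r\<^sup>2 sin\<^sup>2 \<theta>\<close> has a nonzero \<open>\<theta>\<close>-derivative away from the equator.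
\<close>

lemma no_common_factor_theta:
  assumes p: "p \<in> U"
    and S3: "\<And>q. q \<in> U \<Longrightarrow> S3 q = c (q $ 2) * g q $ 3 $ 3"
    and S4: "\<And>q. q \<in> U \<Longrightarrow> S4 q = c (q $ 2) * g q $ 4 $ 4"
    and G: "partial_deriv 3 S3 p = G * S3 p" "partial_deriv 3 S4 p = G * S4 p"
  shows "c (p $ 2) = 0 \<or> cos (p $ 3) = 0"
proof (rule ccontr)
  assume contra: "\<not> ?thesis"
  note nz = domainD(2,4)[OF p]
  have "partial_deriv 3 S3 p = 0"
    by (rule partial_deriv_static(3)[OF p, where H = "\<lambda>r \<theta>. c r * r\<^sup>2"])
       (auto simp: S3 metric_nth)
  then have "G = 0"
    using G(1) S3[OF p] nz contra by (simp add: metric_nth)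
  moreover have "partial_deriv 3 S4 p = c (p $ 2) * (p $ 2)\<^sup>2 * (2 * sin (p $ 3) * cos (p $ 3))"
    by (rule partial_deriv_static(3)[OF p, where H = "\<lambda>r \<theta>. c r * (r\<^sup>2 * (sin \<theta>)\<^sup>2)"])
       (auto simp: S4 metric_nth intro!: derivative_eq_intros)
  ultimately show False
    using G(2) nz contra by simp
qed

text \<open>
  The mixed planes, spanned by one of the first two and one of the last two coordinate directions,
  all have sectional curvature \<open>- f' / (2 r)\<close>. The components of such planes with one direction
  fixed and the other varying within its pair are thus a pair with a common radial coefficient; for
  the type (0,4) tensor the coefficient also absorbs the metric component of the fixed direction.
\<close>

lemma no_inheritance:
  assumes \<xi>: "\<xi> = coord_field 2 \<or> \<xi> = coord_field 3"
    and p: "p \<in> U" "cos (p $ 3) \<noteq> 0"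
    and f': "f' (p $ 2) \<noteq> 0"
    and ric: "ricci_coeff 1 (p $ 2) \<noteq> 0" "ricci_coeff 3 (p $ 2) \<noteq> 0"
  shows "\<not> ricci_inheritance U g \<xi>"
    and "\<not> curvature_inheritance13 U g \<xi>"
    and "\<not> curvature_inheritance04 U g \<xi>"
proof -
  have r: "p $ 2 > 0"
    by (rule domainD[OF p(1)])
  have diff: "f field_differentiable at (p $ 2)" "f' field_differentiable at (p $ 2)"
    "f'' field_differentiable at (p $ 2)"
    using deriv_f[OF r] deriv_f'[OF r] differentiable_f''[OF r] by (auto simp: field_differentiable_def)
  show "\<not> ricci_inheritance U g \<xi>"
  proof
    assume "ricci_inheritance U g \<xi>"
    then obtain G where G: "\<And>i j. lie_deriv02 \<xi> (ricci g) i j p = G * ricci g i j p"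
      unfolding ricci_inheritance_def using p by blast
    show False
      using \<xi>
    proof
      assume "\<xi> = coord_field 2"
      then have "partial_deriv 2 (ricci g j j) p = G * ricci g j j p" for j
        using G by (simp add: lie_deriv_coord)
      moreover have "ricci_coeff 1 field_differentiable at (p $ 2)"
        unfolding ricci_coeff_values(1)[abs_def] using r by (intro derivative_intros diff) auto
      moreover have "ricci_coeff 2 = ricci_coeff 1"
        by (simp add: fun_eq_iff ricci_coeff_values)
      ultimately show False
        using no_common_factor_r[OF p(1), of "ricci_coeff 1" "ricci g 1 1" "ricci g 2 2" G] ric f'
        by (simp add: ricci_diagonal)
    next
      assume "\<xi> = coord_field 3"
      then have "partial_deriv 3 (ricci g j j) p = G * ricci g j j p" for j
        using G by (simp add: lie_deriv_coord)
      moreover have "ricci_coeff 4 = ricci_coeff 3"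
        by (simp add: fun_eq_iff ricci_coeff_values)
      ultimately show False
        using no_common_factor_theta[OF p(1), of "ricci g 3 3" "ricci_coeff 3" "ricci g 4 4" G] ric p
        by (simp add: ricci_diagonal)
    qed
  qed
  show "\<not> curvature_inheritance13 U g \<xi>"
  proof
    assume "curvature_inheritance13 U g \<xi>"
    then obtain G where G: "\<And>l i j k. lie_deriv13 \<xi> (riemann13 g) l i j k p = G * riemann13 g l i j k p"
      unfolding curvature_inheritance13_def using p by blast
    show False
      using \<xi>
    proof
      assume "\<xi> = coord_field 2"
      then have "partial_deriv 2 (riemann13 g l i j k) p = G * riemann13 g l i j k p" for l i j k
        using G by (simp add: lie_deriv_coord)
      moreover have "(\<lambda>r. - f' r / (2 * r)) field_differentiable at (p $ 2)"
        using r by (intro derivative_intros diff) auto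
      ultimately show False
        using no_common_factor_r[OF p(1), of "\<lambda>r. - f' r / (2 * r)" "riemann13 g 3 3 1 1" "riemann13 g 3 3 2 2" G] r f'
        by (simp add: riemann13_sectional sectional_def)
    next
      assume "\<xi> = coord_field 3"
      then have "partial_deriv 3 (riemann13 g l i j k) p = G * riemann13 g l i j k p" for l i j k
        using G by (simp add: lie_deriv_coord)
      then show False
        using no_common_factor_theta[OF p(1), of "riemann13 g 1 1 3 3" "\<lambda>r. - f' r / (2 * r)" "riemann13 g 1 1 4 4" G] r f' p
        by (simp add: riemann13_sectional sectional_def)
    qed
  qed
  show "\<not> curvature_inheritance04 U g \<xi>"
  proof
    assume "curvature_inheritance04 U g \<xi>"
    then obtain G where G: "\<And>i j k l. lie_deriv04 \<xi> (riemann04 g) i j k l p = G * riemann04 g i j k l p"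
      unfolding curvature_inheritance04_def using p by blast
    show False
      using \<xi>
    proof
      assume "\<xi> = coord_field 2"
      then have "partial_deriv 2 (riemann04 g i j k l) p = G * riemann04 g i j k l p" for i j k l
        using G by (simp add: lie_deriv_coord)
      moreover have "(\<lambda>r. - f' r / (2 * r) * r\<^sup>2) field_differentiable at (p $ 2)"
        using r by (intro derivative_intros diff) auto
      ultimately show False
        using no_common_factor_r[OF p(1), of "\<lambda>r. - f' r / (2 * r) * r\<^sup>2" "riemann04 g 3 1 1 3" "riemann04 g 3 2 2 3" G] r f'
        by (simp add: riemann04_sectional sectional_def metric_nth[of _ 3 3] mult_ac)
    next
      assume "\<xi> = coord_field 3"
      then have "partial_deriv 3 (riemann04 g i j k l) p = G * riemann04 g i j k l p" for i j k l
        using G by (simp add: lie_deriv_coord)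
      then show False
        using no_common_factor_theta[OF p(1), of "riemann04 g 1 3 3 1" "\<lambda>r. - f' r / (2 * r) * - f r" "riemann04 g 1 4 4 1" G]
          r f' p domainD[OF p(1)]
        by (simp add: riemann04_sectional sectional_def metric_nth[of _ 1 1] mult_ac)
    qed
  qed
qed

end

section \<open>Reissner-Nordstrom-de Sitter spacetime\<close>

lemma collineation_imp_inheritance:
  "ricci_collineation U g \<xi> \<Longrightarrow> ricci_inheritance U g \<xi>"
  "curvature_collineation13 U g \<xi> \<Longrightarrow> curvature_inheritance13 U g \<xi>"
  "curvature_collineation04 U g \<xi> \<Longrightarrow> curvature_inheritance04 U g \<xi>"
  unfolding ricci_collineation_def ricci_inheritance_def
    curvature_collineation13_def curvature_inheritance13_def
    curvature_collineation04_def curvature_inheritance04_def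
  by (rule exI[of _ "\<lambda>_. 0"], simp)+

lemma rnds_domain_eq: "rnds_domain M e \<Lambda> = static_domain (rnds_f M e \<Lambda>)"
  by (simp add: rnds_domain_def static_domain_def)

lemma rnds_metric_eq: "rnds_metric M e \<Lambda> = static_metric (rnds_f M e \<Lambda>)"
  by (simp add: rnds_metric_def static_metric_def fun_eq_iff)

definition rnds_f' :: "real \<Rightarrow> real \<Rightarrow> real \<Rightarrow> real \<Rightarrow> real" where
  "rnds_f' M e \<Lambda> r = 2 * M / r\<^sup>2 - 2 * e\<^sup>2 / r ^ 3 - 2 * \<Lambda> * r"

definition rnds_f'' :: "real \<Rightarrow> real \<Rightarrow> real \<Rightarrow> real \<Rightarrow> real" where
  "rnds_f'' M e \<Lambda> r = - 4 * M / r ^ 3 + 6 * e\<^sup>2 / r ^ 4 - 2 * \<Lambda>"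

lemma static_profile_rnds: "static_profile (rnds_f M e \<Lambda>) (rnds_f' M e \<Lambda>) (rnds_f'' M e \<Lambda>)"
proof
  fix r :: real assume r: "r > 0"
  show "(rnds_f M e \<Lambda> has_real_derivative rnds_f' M e \<Lambda> r) (at r)"
    unfolding rnds_f_def[abs_def] rnds_f'_def using r
    by (auto intro!: derivative_eq_intros simp: field_simps eval_nat_numeral)
  show "(rnds_f' M e \<Lambda> has_real_derivative rnds_f'' M e \<Lambda> r) (at r)"
    unfolding rnds_f'_def[abs_def] rnds_f''_def using r
    by (auto intro!: derivative_eq_intros simp: field_simps eval_nat_numeral)
  show "rnds_f'' M e \<Lambda> field_differentiable at r"
    unfolding rnds_f''_def[abs_def] using r by (intro derivative_intros) auto
qed

text \<open>
  Multiplied by a suitable power of \<open>r\<close>, the three functions are polynomials in \<open>r\<close> whose value at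
  \<open>0\<close> is a nonzero multiple of \<open>e\<^sup>2\<close>, so none of them vanishes for small \<open>r > 0\<close>.
\<close>

lemma exists_generic_radius:
  assumes "e \<noteq> 0"
  obtains r where "r > 0" "rnds_f M e \<Lambda> r \<noteq> 0" "rnds_f' M e \<Lambda> r \<noteq> 0" "3 * \<Lambda> - e\<^sup>2 / r ^ 4 \<noteq> 0"
proof -
  have 0: "\<forall>\<^sub>F r in at_right 0. h r \<noteq> 0" if "isCont h 0" "h 0 \<noteq> 0" for h :: "real \<Rightarrow> real"
    using tendsto_imp_eventually_ne[of h "h 0" "at_right 0" 0] that
    by (auto simp: isCont_def intro: tendsto_mono at_le)
  have "\<forall>\<^sub>F r in at_right 0. r\<^sup>2 - 2 * M * r + e\<^sup>2 - \<Lambda> * r ^ 4 \<noteq> 0"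
    "\<forall>\<^sub>F r in at_right 0. 2 * M * r - 2 * e\<^sup>2 - 2 * \<Lambda> * r ^ 4 \<noteq> 0"
    "\<forall>\<^sub>F r in at_right 0. 3 * \<Lambda> * r ^ 4 - e\<^sup>2 \<noteq> 0"
    by (rule 0; use assms in \<open>auto intro!: continuous_intros\<close>)+
  moreover have "\<forall>\<^sub>F r in at_right (0::real). r > 0"
    by (simp add: eventually_at_right_less)
  ultimately have "\<forall>\<^sub>F r in at_right 0. r > 0 \<and> r\<^sup>2 - 2 * M * r + e\<^sup>2 - \<Lambda> * r ^ 4 \<noteq> 0 \<and>
      2 * M * r - 2 * e\<^sup>2 - 2 * \<Lambda> * r ^ 4 \<noteq> 0 \<and> 3 * \<Lambda> * r ^ 4 - e\<^sup>2 \<noteq> 0"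
    by eventually_elim simp
  then obtain r where r: "r > 0" "r\<^sup>2 - 2 * M * r + e\<^sup>2 - \<Lambda> * r ^ 4 \<noteq> 0"
      "2 * M * r - 2 * e\<^sup>2 - 2 * \<Lambda> * r ^ 4 \<noteq> 0" "3 * \<Lambda> * r ^ 4 - e\<^sup>2 \<noteq> 0"
    using eventually_happens'[OF trivial_limit_at_right_real] by blast
  have eq: "rnds_f M e \<Lambda> r = (r\<^sup>2 - 2 * M * r + e\<^sup>2 - \<Lambda> * r ^ 4) / r\<^sup>2"
    "rnds_f' M e \<Lambda> r = (2 * M * r - 2 * e\<^sup>2 - 2 * \<Lambda> * r ^ 4) / r ^ 3"
    "3 * \<Lambda> - e\<^sup>2 / r ^ 4 = (3 * \<Lambda> * r ^ 4 - e\<^sup>2) / r ^ 4"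
    using r(1) by (simp_all add: rnds_f_def rnds_f'_def field_simps eval_nat_numeral)
  show ?thesis
    by (rule that[OF r(1)]) (use r in \<open>simp_all only: eq divide_eq_0_iff power_eq_0_iff, simp_all\<close>)
qed

theorem mainTheorem6:
  fixes M e \<Lambda> :: real and \<xi> :: "real ^ 4 \<Rightarrow> real ^ 4"
  assumes "M > 0" and "e \<noteq> 0" and "\<Lambda> > 0"
    and "\<xi> = coord_field 2 \<or> \<xi> = coord_field 3"
  shows "(\<not> ricci_collineation (rnds_domain M e \<Lambda>) (rnds_metric M e \<Lambda>) \<xi> \<and>
       \<not> ricci_inheritance (rnds_domain M e \<Lambda>) (rnds_metric M e \<Lambda>) \<xi>)
    \<and> (\<not> curvature_collineation13 (rnds_domain M e \<Lambda>) (rnds_metric M e \<Lambda>) \<xi> \<and>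
       \<not> curvature_collineation04 (rnds_domain M e \<Lambda>) (rnds_metric M e \<Lambda>) \<xi>)
    \<and> (\<not> curvature_inheritance13 (rnds_domain M e \<Lambda>) (rnds_metric M e \<Lambda>) \<xi> \<and>
       \<not> curvature_inheritance04 (rnds_domain M e \<Lambda>) (rnds_metric M e \<Lambda>) \<xi>)"
proof -
  interpret static_profile "rnds_f M e \<Lambda>" "rnds_f' M e \<Lambda>" "rnds_f'' M e \<Lambda>"
    by (rule static_profile_rnds)
  obtain r where r: "r > 0" "rnds_f M e \<Lambda> r \<noteq> 0" "rnds_f' M e \<Lambda> r \<noteq> 0" "3 * \<Lambda> - e\<^sup>2 / r ^ 4 \<noteq> 0"
    using exists_generic_radius[OF assms(2)] .
  \<comment> \<open>A point off the equator, where \<open>cos \<theta> \<noteq> 0\<close>.\<close>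
  define p :: "real ^ 4" where "p = (\<chi> i. if i = 2 then r else pi / 4)"
  have p: "p $ 2 = r" "p $ 3 = pi / 4"
    by (simp_all add: p_def)
  have "p \<in> U"
    using r by (simp add: static_domain_def p)
  moreover have "ricci_coeff 1 r = 3 * \<Lambda> - e\<^sup>2 / r ^ 4" "ricci_coeff 3 r = 3 * \<Lambda> + e\<^sup>2 / r ^ 4"
    using r(1) by (simp_all add: ricci_coeff_values rnds_f_def rnds_f'_def rnds_f''_def field_simps eval_nat_numeral)
  moreover have "3 * \<Lambda> + e\<^sup>2 / r ^ 4 > 0"
    using assms(3) r(1) by (simp add: add_pos_nonneg)
  moreover have "cos (p $ 3) \<noteq> 0"
    by (simp add: p cos_45)
  ultimately have "\<not> ricci_inheritance U g \<xi>" "\<not> curvature_inheritance13 U g \<xi>"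
    "\<not> curvature_inheritance04 U g \<xi>"
    using no_inheritance[OF assms(4), of p] r by (simp_all add: p)
  then show ?thesis
    unfolding rnds_domain_eq rnds_metric_eq using collineation_imp_inheritance by blast
qed

end
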